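(* Let $\alpha\in(0,1)$, let $\mathfrak{w}:[0,\infty)\to\Omega$ be a fuzzy function and let $\tau_0\in(0,\infty)$. (a) $\mathfrak{w}$ is $[(i)\text{-}gH]$-differentiable at $\tau_0$ if and only if $\mathfrak{w}$ is $\alpha_{i.gH}$-differentiable at $\tau_0$. (b) $\mathfrak{w}$ is $[(ii)\text{-}gH]$-differentiable at $\tau_0$ if and only if $\mathfrak{w}$ is $\alpha_{ii.gH}$-differentiable at $\tau_0$.
   Context: A fuzzy number is a map $\mathcal{P}:\mathbb{R}\to[0,1]$ that is normal, fuzzy convex, upper semicontinuous and compactly supported; $\mathcal{F}$ is the set of fuzzy numbers. For $r\in(0,1]$, $[\mathcal{P}]^r=\{x:\mathcal{P}(x)\ge r\}$, and $[\mathcal{P}]^0=\overline{\{x:\mathcal{P}(x)>0\}}$; each $[\mathcal{P}]^r=[\mathcal{P}_1(r),\mathcal{P}_2(r)]$ is a compact interval. Addition $\oplus$ and multiplication by real scalars are levelwise: $[\mathcal{P}\oplus\mathcal{Q}]^r=[\mathcal{P}]^r+[\mathcal{Q}]^r$, $[c\,\mathcal{P}]^r=c[\mathcal{P}]^r$. $\Omega\subset\mathcal{F}$ is the set of triangular fuzzy numbers $(p_1,p_2,p_3)$, $p_1\le p_2\le p_3$, with $r$-cuts $[p_1+r(p_2-p_1),\,p_3-r(p_3-p_2)]$. A function with values in $\Omega$ is written $\mathfrak{w}=(\mathfrak{w}_1,\mathfrak{w}_2,\mathfrak{w}_3)$ with real-valued $\mathfrak{w}_i$. The generalized Hukuhara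 difference $\mathcal{P}\ominus_{gH}\mathcal{Q}$ is the fuzzy number $\mathcal{R}$ (if it exists) such that $\mathcal{P}=\mathcal{Q}\oplus\mathcal{R}$ or $\mathcal{Q}=\mathcal{P}\oplus(-1)\mathcal{R}$. Standing assumption: the gH-differences that occur exist and belong to $\Omega$. Limits are taken in the Hausdorff metric $D(\mathcal{P},\mathcal{Q})=\sup_{r\in[0,1]}\max\{|\mathcal{P}_1(r)-\mathcal{Q}_1(r)|,|\mathcal{P}_2(r)-\mathcal{Q}_2(r)|\}$. The gH-derivative at $\tau_0$ is $\mathfrak{w}'_{gH}(\tau_0)=\lim_{h\to0}\frac{\mathfrak{w}(\tau_0+h)\ominus_{gH}\mathfrak{w}(\tau_0)}{h}$ (if it exists in $\mathcal{F}$). $\mathfrak{w}$ is $[(i)\text{-}gH]$-differentiable at $\tau_0$ if this exists and equals $(\mathfrak{w}_1'(\tau_0),\mathfrak{w}_2'(\tau_0),\mathfrak{w}_3'(\tau_0))$, and $[(ii)\text{-}gH]$-differentiable at $\tau_0$ if it exists and equals $(\mathfrak{w}_3'(\tau_0),\mathfrak{w}_2'(\tau_0),\mathfrak{w}_1'(\tau_0))$. $\mathfrak{w}$ is $\alpha_{gH}$-differentiable at $\tau_0>0$ if ${}_{gH}\mathbf{T}^{0}_{\alpha}(\mathfrak{w}(\tau_0))=\lim_{\epsilon\to0}\frac{\mathfrak{w}(\tau_0+\epsilon\tau_0^{1-\alpha})\ominus_{gH}\mathfrak{w}(\tau_0)}{\epsilon}$ exists in $\mathcal{F}$. For real-valued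 $f$, $T^0_\alpha f(\tau_0)=\lim_{\epsilon\to0}\frac{f(\tau_0+\epsilon\tau_0^{1-\alpha})-f(\tau_0)}{\epsilon}$. An $\alpha_{gH}$-differentiable $\mathfrak{w}$ is $\alpha_{i.gH}$-differentiable at $\tau_0$ if ${}_{gH}\mathbf{T}^{0}_{\alpha}(\mathfrak{w}(\tau_0))=(T^0_\alpha\mathfrak{w}_1(\tau_0),T^0_\alpha\mathfrak{w}_2(\tau_0),T^0_\alpha\mathfrak{w}_3(\tau_0))$, and $\alpha_{ii.gH}$-differentiable at $\tau_0$ if ${}_{gH}\mathbf{T}^{0}_{\alpha}(\mathfrak{w}(\tau_0))=(T^0_\alpha\mathfrak{w}_3(\tau_0),T^0_\alpha\mathfrak{w}_2(\tau_0),T^0_\alpha\mathfrak{w}_1(\tau_0))$. *)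

theory Defs
  imports "HOL-Analysis.Analysis"
begin

section \<open>Fuzzy numbers and their level cuts\<close>

definition upper_semicont :: "(real \<Rightarrow> real) \<Rightarrow> bool" where
  "upper_semicont f \<longleftrightarrow> (\<forall>x c. f x < c \<longrightarrow> (\<forall>\<^sub>F y in nhds x. f y < c))"

definition fuzzy_convex :: "(real \<Rightarrow> real) \<Rightarrow> bool" where
  "fuzzy_convex f \<longleftrightarrow>
     (\<forall>x y. \<forall>t\<in>{0..1}. min (f x) (f y) \<le> f (t * x + (1 - t) * y))"

definition fuzzy_number :: "(real \<Rightarrow> real) \<Rightarrow> bool" where
  "fuzzy_number f \<longleftrightarrow> range f \<subseteq> {0..1} \<and> (\<exists>x. f x = 1) \<and> fuzzy_convex f \<and>
     upper_semicont f \<and> compact (closure {x. f x > 0})"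

definition raw_cut :: "(real \<Rightarrow> real) \<Rightarrow> real \<Rightarrow> real set" where
  "raw_cut f r = (if r = 0 then closure {x. f x > 0} else {x. f x \<ge> r})"

lemma upper_semicont_closed:
  assumes "\<And>r. r \<in> {0<..1} \<Longrightarrow> closed {x. f x \<ge> r}" "range f \<subseteq> {0..1}"
  shows "upper_semicont f"
  unfolding upper_semicont_def
proof (intro allI impI)
  fix x c assume *: "f x < c"
  have f01: "0 \<le> f y" "f y \<le> 1" for y using assms(2) by (auto simp: image_subset_iff)
  show "\<forall>\<^sub>F y in nhds x. f y < c"
  proof (cases "c \<le> 1")
    case True
    then have "c \<in> {0<..1}" using * f01(1)[of x] by auto
    then have "open (- {x. f x \<ge> c})" using assms(1) by auto
    moreover have "x \<in> - {x. f x \<ge> c}" using * by auto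
    ultimately have "\<forall>\<^sub>F y in nhds x. y \<in> - {x. f x \<ge> c}" by (rule eventually_nhds_in_open)
    then show ?thesis by (rule eventually_mono) auto
  next
    case False
    then have "f y < c" for y using f01(2)[of y] by linarith
    then show ?thesis by simp
  qed
qed

lemma closed_upper_level:
  assumes "upper_semicont f" shows "closed {x. f x \<ge> r}"
proof -
  have "open {x. f x < r}"
  proof (subst open_subopen, intro ballI)
    fix x assume "x \<in> {x. f x < r}"
    then obtain T where "open T" "x \<in> T" "\<forall>y\<in>T. f y < r"
      using assms unfolding upper_semicont_def eventually_nhds by (metis mem_Collect_eq)
    then show "\<exists>T. open T \<and> x \<in> T \<and> T \<subseteq> {x. f x < r}" by blast
  qed
  moreover have "{x. f x < r} = - {x. f x \<ge> r}" by auto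
  ultimately show ?thesis by (simp add: closed_def)
qed

lemma fuzzy_number_indicator_point: "fuzzy_number (\<lambda>x. if x = a then 1 else 0)"
proof -
  have eq: "{x. (if x = a then 1 else 0::real) > 0} = {a}" by auto
  have "closed {x. (if x = a then 1 else 0::real) \<ge> r}" if "r \<in> {0<..1}" for r
  proof -
    have "{x. (if x = a then 1 else 0::real) \<ge> r} = {a}" using that by auto
    then show ?thesis by simp
  qed
  then have "upper_semicont (\<lambda>x. if x = a then 1 else 0)"
    by (rule upper_semicont_closed) auto
  then show ?thesis
    unfolding fuzzy_number_def eq fuzzy_convex_def by (auto simp: algebra_simps)
qed

typedef fuzzy = "{f. fuzzy_number f}" morphisms membership Abs_fuzzy
  using fuzzy_number_indicator_point by blast

definition rcut :: "fuzzy \<Rightarrow> real \<Rightarrow> real set" where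
  "rcut P r = raw_cut (membership P) r"

definition lower :: "fuzzy \<Rightarrow> real \<Rightarrow> real" where "lower P r = Inf (rcut P r)"
definition upper :: "fuzzy \<Rightarrow> real \<Rightarrow> real" where "upper P r = Sup (rcut P r)"

lemma fuzzy_number_membership: "fuzzy_number (membership P)"
  using membership by auto

lemma membership_bounds: "0 \<le> membership P x" "membership P x \<le> 1"
  using fuzzy_number_membership[of P] unfolding fuzzy_number_def image_subset_iff by auto

lemma cut_pos: "r > 0 \<Longrightarrow> rcut P r = {x. membership P x \<ge> r}"
  by (simp add: rcut_def raw_cut_def)

lemma cut_0: "rcut P 0 = closure {x. membership P x > 0}"
  by (simp add: rcut_def raw_cut_def)

lemma cut_antimono:
  assumes "0 \<le> r" "r \<le> s" shows "rcut P s \<subseteq> rcut P r"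
proof (cases "r = 0")
  case True
  show ?thesis
  proof (cases "s = 0")
    case False
    then have "{x. membership P x \<ge> s} \<subseteq> {x. membership P x > 0}" using assms by auto
    then show ?thesis using False True assms closure_subset cut_0[of P] cut_pos[of s P]
      by fastforce
  qed (use True in auto)
qed (use assms cut_pos[of r P] cut_pos[of s P] in auto)

lemma interval_of_real_compact:
  fixes S :: "real set"
  assumes "compact S" "S \<noteq> {}" "is_interval S"
  shows "S = {Inf S..Sup S}" "Inf S \<le> Sup S"
proof -
  have b: "bounded S" "closed S" using assms(1) compact_imp_bounded compact_imp_closed by auto
  have bb: "bdd_above S" "bdd_below S"
    using b bounded_imp_bdd_above bounded_imp_bdd_below by auto
  have i: "Inf S \<in> S" "Sup S \<in> S"
    using b bb assms(2) closed_contains_Inf closed_contains_Sup by auto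
  show "S = {Inf S..Sup S}"
  proof
    show "S \<subseteq> {Inf S..Sup S}" using bb by (auto intro: cInf_lower cSup_upper)
    show "{Inf S..Sup S} \<subseteq> S"
      using i assms(3) unfolding is_interval_1 by (meson atLeastAtMost_iff subsetI)
  qed
  show "Inf S \<le> Sup S" using bb cInf_lower i by auto
qed

lemma cut_is_interval:
  assumes "0 \<le> r" shows "is_interval (rcut P r)"
proof -
  have fc: "min (membership P x) (membership P y) \<le> membership P z"
    if "x \<le> z" "z \<le> y" for x y z
  proof (cases "x = y")
    case False
    define t where "t = (y - z) / (y - x)"
    have "t \<in> {0..1}" using that False by (auto simp: t_def divide_simps)
    moreover have "t * x + (1 - t) * y = y - t * (y - x)" by (simp add: algebra_simps)
    then have "t * x + (1 - t) * y = z" using False by (simp add: t_def)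
    ultimately show ?thesis
      using fuzzy_number_membership[of P] unfolding fuzzy_number_def fuzzy_convex_def by metis
  qed (use that in auto)
  show ?thesis
  proof (cases "r = 0")
    case True
    have "is_interval {x. membership P x > 0}"
      unfolding is_interval_1 using fc by (fastforce simp: min_def split: if_splits)
    then have "convex (closure {x. membership P x > 0})"
      by (simp add: is_interval_convex convex_closure)
    then show ?thesis using True cut_0 is_interval_convex_1 by simp
  next
    case False
    then show ?thesis using assms unfolding is_interval_1
      using fc by (fastforce simp: cut_pos min_def split: if_splits)
  qed
qed

lemma cut_compact: assumes "0 \<le> r" shows "compact (rcut P r)"
proof -
  have 0: "compact (rcut P 0)"
    using fuzzy_number_membership[of P] unfolding cut_0 fuzzy_number_def by auto
  show ?thesis
  proof (cases "r = 0")
    case False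
    have "closed (rcut P r)"
      using False assms fuzzy_number_membership[of P] closed_upper_level cut_pos
      unfolding fuzzy_number_def by simp
    then have "compact (rcut P 0 \<inter> rcut P r)" using 0 by (rule compact_Int_closed[rotated])
    moreover have "rcut P 0 \<inter> rcut P r = rcut P r" using cut_antimono[of 0 r] assms by auto
    ultimately show ?thesis by simp
  qed (use 0 in auto)
qed

lemma cut_nonempty: assumes "r \<in> {0..1}" shows "rcut P r \<noteq> {}"
proof -
  obtain x where "membership P x = 1"
    using fuzzy_number_membership[of P] unfolding fuzzy_number_def by auto
  then have "x \<in> rcut P 1" by (simp add: cut_pos)
  then show ?thesis using cut_antimono[of r 1 P] assms by auto
qed

lemma cut_eq:
  assumes "r \<in> {0..1}"
  shows "rcut P r = {lower P r..upper P r}" and lower_le_upper: "lower P r \<le> upper P r"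
  using interval_of_real_compact[of "rcut P r"] cut_compact cut_nonempty cut_is_interval assms
  unfolding lower_def upper_def by auto

lemma cut_inject:
  assumes "\<And>r. r \<in> {0..1} \<Longrightarrow> rcut P r = rcut Q r" shows "P = Q"
proof -
  have le: "membership P x \<le> membership Q x"
    if "\<And>r. r \<in> {0..1} \<Longrightarrow> rcut P r = rcut Q r" for P Q x
  proof (cases "membership P x = 0")
    case False
    let ?r = "membership P x"
    have r: "?r \<in> {0<..1}" using False membership_bounds[of P x] by auto
    then have "x \<in> rcut P ?r" by (auto simp: cut_pos)
    then have "x \<in> rcut Q ?r" using that r by auto
    then show ?thesis using r by (auto simp: cut_pos)
  qed (simp add: membership_bounds)
  have "membership P = membership Q"
    using le[OF assms] le[OF assms[symmetric]] by (intro ext antisym) auto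
  then show ?thesis by (simp add: membership_inject)
qed

lemma ends_inject:
  assumes "\<And>r. r \<in> {0..1} \<Longrightarrow> lower P r = lower Q r"
    and "\<And>r. r \<in> {0..1} \<Longrightarrow> upper P r = upper Q r"
  shows "P = Q"
  by (rule cut_inject) (use assms cut_eq in auto)

lemma ends_of_cut:
  assumes "rcut P r = {a..b}" "a \<le> b" shows "lower P r = a" "upper P r = b"
  using assms by (auto simp: lower_def upper_def)

lemma ends_monotone:
  assumes "0 \<le> r" "r \<le> s" "s \<le> 1"
  shows lower_mono: "lower P r \<le> lower P s" and upper_antimono: "upper P s \<le> upper P r"
proof -
  have *: "r \<in> {0..1}" "s \<in> {0..1}" using assms by auto
  have "{lower P s..upper P s} \<subseteq> {lower P r..upper P r}"
    using cut_antimono[of r s P] assms by (simp add: cut_eq(1)[OF *(1)] cut_eq(1)[OF *(2)])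
  then show "lower P r \<le> lower P s" "upper P s \<le> upper P r"
    using cut_eq(2)[OF *(2), of P] by simp_all
qed

text \<open>
  The endpoint functions of a fuzzy number are one-sidedly continuous, and conversely monotone
  endpoint functions with these limits come from a fuzzy number (Goetschel and Voxman).
\<close>

lemma inter_cut:
  assumes "r \<in> {0<..1}" "\<And>s. 0 < s \<Longrightarrow> s < r \<Longrightarrow> x \<in> rcut P s" shows "x \<in> rcut P r"
proof -
  have "s \<le> membership P x" if "s < r" for s
    using assms(2)[of s] that membership_bounds[of P x] by (cases "s > 0") (auto simp: cut_pos)
  then have "r \<le> membership P x" by (rule dense_le)
  then show ?thesis using assms by (simp add: cut_pos)
qed

lemma point_near_cut0:
  assumes "a \<in> rcut P 0" "open S" "a \<in> S"
  obtains x s where "x \<in> S" "s \<in> {0<..1}" "x \<in> rcut P s"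
proof -
  obtain x where "x \<in> S" "membership P x > 0"
    using assms unfolding cut_0 closure_iff_nhds_not_empty by blast
  then show ?thesis using that[of x "membership P x"] membership_bounds by (auto simp: cut_pos)
qed

lemma left_tendsto:
  assumes r: "r \<in> {0<..1}"
  shows "(lower P \<longlongrightarrow> lower P r) (at_left r)" and "(upper P \<longlongrightarrow> upper P r) (at_left r)"
proof -
  have ev: "\<forall>\<^sub>F s in at_left r. s0 < s \<and> s < r" if "s0 < r" for s0
    using eventually_at_left_real[OF that] by (rule eventually_mono) auto
  have ur: "lower P r \<le> upper P r" using r by (intro cut_eq) auto
  show "(lower P \<longlongrightarrow> lower P r) (at_left r)"
  proof (rule order_tendstoI)
    fix a assume a: "a < lower P r"
    have "a \<notin> rcut P r" using a r cut_eq(1)[of r P] by auto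
    then obtain s where s: "0 < s" "s < r" "a \<notin> rcut P s" using inter_cut[OF r] by blast
    have "a \<le> upper P s" using a ur s r upper_antimono[of s r P] by auto
    then have *: "a < lower P s" using s r cut_eq(1)[of s P] by auto
    show "\<forall>\<^sub>F x in at_left r. a < lower P x"
      by (rule eventually_mono[OF ev[OF s(2)]]) (use s r in \<open>auto intro!: less_le_trans[OF *] lower_mono\<close>)
  next
    fix a assume a: "lower P r < a"
    show "\<forall>\<^sub>F x in at_left r. lower P x < a"
      by (rule eventually_mono[OF ev[of 0]]) (use r in \<open>auto intro!: le_less_trans[OF _ a] lower_mono\<close>)
  qed
  show "(upper P \<longlongrightarrow> upper P r) (at_left r)"
  proof (rule order_tendstoI)
    fix a assume a: "a > upper P r"
    have "a \<notin> rcut P r" using a r cut_eq(1)[of r P] by auto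
    then obtain s where s: "0 < s" "s < r" "a \<notin> rcut P s" using inter_cut[OF r] by blast
    have "a \<ge> lower P s" using a ur s r lower_mono[of s r P] by auto
    then have *: "a > upper P s" using s r cut_eq(1)[of s P] by auto
    show "\<forall>\<^sub>F x in at_left r. upper P x < a"
      by (rule eventually_mono[OF ev[OF s(2)]]) (use s r in \<open>auto intro!: le_less_trans[OF _ *] upper_antimono\<close>)
  next
    fix a assume a: "upper P r > a"
    show "\<forall>\<^sub>F x in at_left r. a < upper P x"
      by (rule eventually_mono[OF ev[of 0]]) (use r in \<open>auto intro!: less_le_trans[OF a] upper_antimono\<close>)
  qed
qed

lemma right_tendsto:
  shows "(lower P \<longlongrightarrow> lower P 0) (at_right 0)" and "(upper P \<longlongrightarrow> upper P 0) (at_right 0)"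
proof -
  have ev: "\<forall>\<^sub>F s in at_right 0. 0 < s \<and> s < s0" if "0 < s0" for s0 :: real
    using eventually_at_right_real[OF that] by (rule eventually_mono) auto
  have c0: "lower P 0 \<in> rcut P 0" "upper P 0 \<in> rcut P 0"
    using cut_eq[of 0 P] by auto
  show "(lower P \<longlongrightarrow> lower P 0) (at_right 0)"
  proof (rule order_tendstoI)
    fix a assume "lower P 0 < a"
    then obtain x s where s: "x \<in> {..<a}" "s \<in> {0<..1}" "x \<in> rcut P s"
      using point_near_cut0[OF c0(1), of "{..<a}"] by auto
    then have *: "lower P s < a" using cut_eq(1)[of s P] by auto
    show "\<forall>\<^sub>F x in at_right 0. lower P x < a"
      by (intro eventually_mono[OF ev[of s]]) (use s in \<open>auto intro!: le_less_trans[OF _ *] lower_mono\<close>)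
  next
    fix a assume a: "a < lower P 0"
    show "\<forall>\<^sub>F x in at_right 0. a < lower P x"
      by (rule eventually_mono[OF ev[of 1]]) (auto intro!: less_le_trans[OF a] lower_mono)
  qed
  show "(upper P \<longlongrightarrow> upper P 0) (at_right 0)"
  proof (rule order_tendstoI)
    fix a assume "upper P 0 > a"
    then obtain x s where s: "x \<in> {a<..}" "s \<in> {0<..1}" "x \<in> rcut P s"
      using point_near_cut0[OF c0(2), of "{a<..}"] by auto
    then have *: "upper P s > a" using cut_eq(1)[of s P] by auto
    show "\<forall>\<^sub>F x in at_right 0. a < upper P x"
      by (intro eventually_mono[OF ev[of s]]) (use s in \<open>auto intro!: less_le_trans[OF *] upper_antimono\<close>)
  next
    fix a assume a: "a > upper P 0"
    show "\<forall>\<^sub>F x in at_right 0. upper P x < a"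
      by (rule eventually_mono[OF ev[of 1]]) (auto intro!: le_less_trans[OF _ a] upper_antimono)
  qed
qed

lemma ex1_fuzzy_of_ends:
  fixes l u :: "real \<Rightarrow> real"
  assumes lu: "l 1 \<le> u 1"
    and mono: "\<And>r s. 0 \<le> r \<Longrightarrow> r \<le> s \<Longrightarrow> s \<le> 1 \<Longrightarrow> l r \<le> l s"
      "\<And>r s. 0 \<le> r \<Longrightarrow> r \<le> s \<Longrightarrow> s \<le> 1 \<Longrightarrow> u s \<le> u r"
    and left: "\<And>r. r \<in> {0<..1} \<Longrightarrow> (l \<longlongrightarrow> l r) (at_left r)"
      "\<And>r. r \<in> {0<..1} \<Longrightarrow> (u \<longlongrightarrow> u r) (at_left r)"
    and right: "(l \<longlongrightarrow> l 0) (at_right 0)" "(u \<longlongrightarrow> u 0) (at_right 0)"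
  shows "\<exists>!P. \<forall>r\<in>{0..1}. rcut P r = {l r..u r}"
proof (rule ex_ex1I)
  define A where "A r = {l r..u r}" for r
  have lu: "l r \<le> u r" if "r \<in> {0..1}" for r
    using mono[of r 1] that lu by auto
  have Amono: "A s \<subseteq> A r" if "0 \<le> r" "r \<le> s" "s \<le> 1" for r s
    using mono[of r s] that by (auto simp: A_def)
  have Aint: "x \<in> A r" if r: "r \<in> {0<..1}" and x: "\<And>s. 0 < s \<Longrightarrow> s < r \<Longrightarrow> x \<in> A s" for r x
  proof -
    have ev: "\<forall>\<^sub>F s in at_left r. 0 < s \<and> s < r"
      using eventually_at_left_real[of 0 r] r by (auto elim!: eventually_mono)
    have "\<forall>\<^sub>F s in at_left r. l s \<le> x" "\<forall>\<^sub>F s in at_left r. x \<le> u s"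
      using ev x by (auto simp: A_def elim!: eventually_mono)
    then have "l r \<le> x" "x \<le> u r"
      using left[OF r] by (auto intro: tendsto_upperbound tendsto_lowerbound)
    then show ?thesis by (simp add: A_def)
  qed
  define f where "f x = Sup (insert 0 {r \<in> {0<..1}. x \<in> A r})" for x
  have bdd: "bdd_above (insert 0 {r \<in> {0<..1::real}. x \<in> A r})" for x
    by (rule bdd_aboveI[of _ 1]) auto
  have f0: "0 \<le> f x" for x unfolding f_def using bdd by (intro cSup_upper) auto
  have f1: "f x \<le> 1" for x unfolding f_def by (rule cSup_least) auto
  have level: "f x \<ge> r \<longleftrightarrow> x \<in> A r" if r: "r \<in> {0<..1}" for x r
  proof
    assume "x \<in> A r"
    then show "f x \<ge> r" unfolding f_def using bdd r by (intro cSup_upper) auto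
  next
    assume fx: "f x \<ge> r"
    show "x \<in> A r"
    proof (rule Aint[OF r])
      fix s assume s: "0 < s" "s < r"
      then have "s < Sup (insert 0 {r \<in> {0<..1}. x \<in> A r})" using fx f_def by auto
      then obtain t where "t \<in> insert 0 {r \<in> {0<..1}. x \<in> A r}" "s < t"
        using less_cSup_iff[OF _ bdd] by blast
      then show "x \<in> A s" using Amono[of s t] s by auto
    qed
  qed
  have support: "closure {x. f x > 0} = A 0"
  proof
    have "{x. f x > 0} \<subseteq> A 0"
    proof
      fix x assume "x \<in> {x. f x > 0}"
      then have "f x \<in> {0<..1}" using f1 by auto
      then show "x \<in> A 0" using level[of "f x" x] Amono[of 0 "f x"] by auto
    qed
    then show "closure {x. f x > 0} \<subseteq> A 0" by (simp add: A_def closure_minimal)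
    have ev: "\<forall>\<^sub>F s::real in at_right 0. 0 < s \<and> s < 1"
      using eventually_at_right_real[of 0 1] by (auto elim!: eventually_mono)
    have pos: "x \<in> closure {x. f x > 0}" if "r \<in> {0<..1}" "x \<in> A r" for r x
      using level[OF that(1), of x] that closure_subset[of "{x. f x > 0}"] by auto
    have ends: "l 0 \<in> closure {x. f x > 0}" "u 0 \<in> closure {x. f x > 0}"
    proof -
      have "l s \<in> closure {x. f x > 0}" if "0 < s \<and> s < 1" for s
        using that lu[of s] by (intro pos[of s]) (auto simp: A_def)
      then have "\<forall>\<^sub>F s in at_right 0. l s \<in> closure {x. f x > 0}"
        by (rule eventually_mono[OF ev])
      then show "l 0 \<in> closure {x. f x > 0}"
        using right(1) by (intro Lim_in_closed_set[of "closure {x. f x > 0}" l "at_right 0"]) auto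
      have "u s \<in> closure {x. f x > 0}" if "0 < s \<and> s < 1" for s
        using that lu[of s] by (intro pos[of s]) (auto simp: A_def)
      then have "\<forall>\<^sub>F s in at_right 0. u s \<in> closure {x. f x > 0}"
        by (rule eventually_mono[OF ev])
      then show "u 0 \<in> closure {x. f x > 0}"
        using right(2) by (intro Lim_in_closed_set[of "closure {x. f x > 0}" u "at_right 0"]) auto
    qed
    have "is_interval {x. f x > 0}"
      unfolding is_interval_1
    proof (intro ballI allI impI)
      fix x y z assume *: "x \<in> {x. f x > 0}" "y \<in> {x. f x > 0}" "x \<le> z \<and> z \<le> y"
      define r where "r = min (f x) (f y)"
      have r: "r \<in> {0<..1}" using * f1[of x] by (auto simp: r_def)
      moreover have "r \<le> f x" "r \<le> f y" by (auto simp: r_def)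
      ultimately have "x \<in> A r" "y \<in> A r" using level by auto
      then have "z \<in> A r" using * by (auto simp: A_def)
      then have "r \<le> f z" using level[OF r] by simp
      then show "z \<in> {x. f x > 0}" using r by auto
    qed
    then have "is_interval (closure {x. f x > 0})"
      by (simp add: is_interval_convex_1 convex_closure)
    then show "A 0 \<subseteq> closure {x. f x > 0}"
      using ends unfolding is_interval_1 A_def by (meson atLeastAtMost_iff subsetI)
  qed
  have "fuzzy_number f"
    unfolding fuzzy_number_def
  proof (intro conjI)
    show "range f \<subseteq> {0..1}" using f0 f1 by auto
    have "f (l 1) = 1"
      using level[of 1 "l 1"] f1[of "l 1"] lu[of 1] by (auto simp: A_def)
    then show "\<exists>x. f x = 1" ..
    show "upper_semicont f"
    proof (rule upper_semicont_closed)
      fix r :: real assume "r \<in> {0<..1}"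
      then have "{x. r \<le> f x} = A r" using level by auto
      then show "closed {x. r \<le> f x}" by (simp add: A_def)
    qed (use f0 f1 in auto)
    show "compact (closure {x. f x > 0})" unfolding support by (simp add: A_def)
    show "fuzzy_convex f"
      unfolding fuzzy_convex_def
    proof (intro allI ballI)
      fix x y t :: real assume t: "t \<in> {0..1}"
      define r where "r = min (f x) (f y)"
      show "min (f x) (f y) \<le> f (t * x + (1 - t) * y)"
      proof (cases "r \<le> 0")
        case True
        then show ?thesis using f0[of "t * x + (1 - t) * y"] by (simp add: r_def)
      next
        case False
        then have r: "r \<in> {0<..1}" using f1[of x] by (auto simp: r_def)
        moreover have "r \<le> f x" "r \<le> f y" by (auto simp: r_def)
        ultimately have xy: "x \<in> A r" "y \<in> A r" using level by auto
        have "convex (A r)" by (simp add: A_def)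
        then have "t *\<^sub>R x + (1 - t) *\<^sub>R y \<in> A r"
          using xy t by (intro convexD) auto
        then show ?thesis using level[OF r] by (simp add: r_def)
      qed
    qed
  qed
  then have m: "membership (Abs_fuzzy f) = f" by (simp add: Abs_fuzzy_inverse)
  have "rcut (Abs_fuzzy f) r = A r" if "r \<in> {0..1}" for r
    using that support level[of r] by (cases "r = 0") (auto simp: rcut_def raw_cut_def m)
  then show "\<exists>P. \<forall>r\<in>{0..1}. rcut P r = {l r..u r}" unfolding A_def by blast
next
  show "P = Q" if "\<forall>r\<in>{0..1}. rcut P r = {l r..u r}" "\<forall>r\<in>{0..1}. rcut Q r = {l r..u r}" for P Q
    using that by (intro cut_inject) auto
qed


section \<open>Levelwise arithmetic and the Hausdorff metric\<close>

text \<open>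
  Sum and real multiple are the unique fuzzy numbers with the prescribed cuts; existence is
  \<open>cut_plus\<close> and \<open>cut_scaleR\<close> below.
\<close>

instantiation fuzzy :: "{plus, scaleR}"
begin

definition plus_fuzzy :: "fuzzy \<Rightarrow> fuzzy \<Rightarrow> fuzzy" where
  "P + Q = (THE R. \<forall>r\<in>{0..1}. rcut R r = {x + y |x y. x \<in> rcut P r \<and> y \<in> rcut Q r})"

definition scaleR_fuzzy :: "real \<Rightarrow> fuzzy \<Rightarrow> fuzzy" where
  "c *\<^sub>R P = (THE R. \<forall>r\<in>{0..1}. rcut R r = (\<lambda>x. c * x) ` rcut P r)"

instance ..

end

lemma cut_plus_ends:
  assumes "r \<in> {0..1}"
  shows "{x + y |x y. x \<in> rcut P r \<and> y \<in> rcut Q r} = {lower P r + lower Q r..upper P r + upper Q r}"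
    (is "?L = ?R")
proof
  show "?L \<subseteq> ?R"
  proof
    fix z assume "z \<in> ?L"
    then obtain x y where "z = x + y" "x \<in> rcut P r" "y \<in> rcut Q r" by blast
    then show "z \<in> ?R" unfolding cut_eq(1)[OF assms] by simp
  qed
  show "?R \<subseteq> ?L"
  proof
    fix z assume z: "z \<in> ?R"
    define x where "x = max (lower P r) (z - upper Q r)"
    have "x \<in> {lower P r..upper P r}" "z - x \<in> {lower Q r..upper Q r}"
      using z cut_eq(2)[OF assms, of P] cut_eq(2)[OF assms, of Q] by (auto simp: x_def max_def)
    then have "x \<in> rcut P r" "z - x \<in> rcut Q r" "z = x + (z - x)"
      by (simp_all add: cut_eq(1)[OF assms])
    then show "z \<in> ?L" by blast
  qed
qed

lemma cut_plus:
  assumes "r \<in> {0..1}"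
  shows "rcut (P + Q) r = {x + y |x y. x \<in> rcut P r \<and> y \<in> rcut Q r}"
proof -
  have "\<exists>!R. \<forall>r\<in>{0..1}. rcut R r = {lower P r + lower Q r..upper P r + upper Q r}"
    by (rule ex1_fuzzy_of_ends; intro add_mono tendsto_add left_tendsto right_tendsto cut_eq(2)
        lower_mono upper_antimono; simp)
  then have "\<exists>!R. \<forall>r\<in>{0..1}. rcut R r = {x + y |x y. x \<in> rcut P r \<and> y \<in> rcut Q r}"
    by (simp add: cut_plus_ends)
  from theI'[OF this] show ?thesis using assms unfolding plus_fuzzy_def by blast
qed

lemma ends_plus:
  assumes "r \<in> {0..1}"
  shows "lower (P + Q) r = lower P r + lower Q r" "upper (P + Q) r = upper P r + upper Q r"
  using ends_of_cut[of "P + Q" r "lower P r + lower Q r" "upper P r + upper Q r"]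
    cut_plus[OF assms, of P Q] cut_plus_ends[OF assms, of P Q]
    add_mono[OF cut_eq(2)[OF assms, of P] cut_eq(2)[OF assms, of Q]] by simp_all

lemma cut_scaleR_ends:
  assumes "r \<in> {0..1}"
  shows "(\<lambda>x. c * x) ` rcut P r =
    (if c \<ge> 0 then {c * lower P r..c * upper P r} else {c * upper P r..c * lower P r})"
  using cut_eq[OF assms, of P]
  by (auto simp: image_mult_atLeastAtMost_if)

lemma cut_scaleR:
  assumes "r \<in> {0..1}"
  shows "rcut (c *\<^sub>R P) r = (\<lambda>x. c * x) ` rcut P r"
proof -
  have "\<exists>!R. \<forall>r\<in>{0..1}. rcut R r = (\<lambda>x. c * x) ` rcut P r"
  proof (cases "c \<ge> 0")
    case True
    have "\<exists>!R. \<forall>r\<in>{0..1}. rcut R r = {c * lower P r..c * upper P r}"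
      by (rule ex1_fuzzy_of_ends; intro mult_left_mono tendsto_mult_left left_tendsto right_tendsto
          cut_eq(2) lower_mono upper_antimono; simp add: True)
    then show ?thesis using True by (simp add: cut_scaleR_ends)
  next
    case False
    then have c: "c \<le> 0" by simp
    have "\<exists>!R. \<forall>r\<in>{0..1}. rcut R r = {c * upper P r..c * lower P r}"
      by (rule ex1_fuzzy_of_ends; intro mult_left_mono_neg tendsto_mult_left left_tendsto
          right_tendsto cut_eq(2) lower_mono upper_antimono; simp add: c)
    then show ?thesis using False by (simp add: cut_scaleR_ends)
  qed
  from theI'[OF this] show ?thesis using assms unfolding scaleR_fuzzy_def by blast
qed

lemma ends_scaleR:
  assumes "r \<in> {0..1}"
  shows "lower (c *\<^sub>R P) r = (if c \<ge> 0 then c * lower P r else c * upper P r)"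
    "upper (c *\<^sub>R P) r = (if c \<ge> 0 then c * upper P r else c * lower P r)"
proof -
  have c: "rcut (c *\<^sub>R P) r =
    (if c \<ge> 0 then {c * lower P r..c * upper P r} else {c * upper P r..c * lower P r})"
    using cut_scaleR[OF assms] cut_scaleR_ends[OF assms] by simp
  show "lower (c *\<^sub>R P) r = (if c \<ge> 0 then c * lower P r else c * upper P r)"
    "upper (c *\<^sub>R P) r = (if c \<ge> 0 then c * upper P r else c * lower P r)"
    using ends_of_cut[of "c *\<^sub>R P" r, OF c[THEN trans]] cut_eq(2)[OF assms, of P]
    by (auto simp: mult_left_mono mult_left_mono_neg)
qed

definition ends_dist :: "fuzzy \<Rightarrow> fuzzy \<Rightarrow> real \<Rightarrow> real" where
  "ends_dist P Q r = max \<bar>lower P r - lower Q r\<bar> \<bar>upper P r - upper Q r\<bar>"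

lemma bdd_above_ends_dist: "bdd_above (ends_dist P Q ` {0..1})"
proof (rule bdd_aboveI2)
  fix r :: real assume "r \<in> {0..1}"
  then show "ends_dist P Q r \<le>
      \<bar>lower P 0\<bar> + \<bar>upper P 0\<bar> + \<bar>lower Q 0\<bar> + \<bar>upper Q 0\<bar>"
    using lower_mono[of 0 r P] lower_mono[of 0 r Q] upper_antimono[of 0 r P]
      upper_antimono[of 0 r Q] cut_eq(2)[of r P] cut_eq(2)[of r Q]
    unfolding ends_dist_def by auto
qed

instantiation fuzzy :: metric_space
begin

definition dist_fuzzy :: "fuzzy \<Rightarrow> fuzzy \<Rightarrow> real" where
  "dist P Q = (SUP r\<in>{0..1}. max \<bar>lower P r - lower Q r\<bar> \<bar>upper P r - upper Q r\<bar>)"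

definition uniformity_fuzzy :: "(fuzzy \<times> fuzzy) filter" where
  "uniformity_fuzzy = (INF e\<in>{0<..}. principal {(P, Q). dist P Q < e})"

definition open_fuzzy :: "fuzzy set \<Rightarrow> bool" where
  "open_fuzzy S = (\<forall>P\<in>S. \<forall>\<^sub>F (P', Q) in uniformity. P' = P \<longrightarrow> Q \<in> S)"

instance
proof
  have d: "dist P Q = (SUP r\<in>{0..1}. ends_dist P Q r)" for P Q :: fuzzy
    unfolding dist_fuzzy_def ends_dist_def ..
  have le: "ends_dist P Q r \<le> dist P Q" if "r \<in> {0..1}" for P Q r
    unfolding d using bdd_above_ends_dist that by (rule cSUP_upper2) auto
  show "dist P Q = 0 \<longleftrightarrow> P = Q" for P Q :: fuzzy
  proof
    assume "dist P Q = 0"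
    then have "ends_dist P Q r \<le> 0" if "r \<in> {0..1}" for r using le[OF that] by metis
    then show "P = Q" by (intro ends_inject) (force simp: ends_dist_def)+
  next
    assume "P = Q"
    then show "dist P Q = 0" by (simp add: d ends_dist_def)
  qed
  show "dist P Q \<le> dist P R + dist Q R" for P Q R :: fuzzy
  proof -
    have "ends_dist P Q r \<le> dist P R + dist Q R" if "r \<in> {0..1}" for r
      using le[OF that, of P R] le[OF that, of Q R] unfolding ends_dist_def by linarith
    then show ?thesis unfolding d[of P Q] by (intro cSUP_least) auto
  qed
qed (simp_all add: uniformity_fuzzy_def open_fuzzy_def)

end


section \<open>Triangular fuzzy numbers\<close>

definition triangular :: "fuzzy \<Rightarrow> real \<Rightarrow> real \<Rightarrow> real \<Rightarrow> bool" where
  "triangular P p1 p2 p3 \<longleftrightarrow> p1 \<le> p2 \<and> p2 \<le> p3 \<and>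
     (\<forall>r\<in>{0..1}. rcut P r = {p1 + r * (p2 - p1)..p3 - r * (p3 - p2)})"

definition Omega :: "fuzzy set" (\<open>\<Omega>\<close>) where
  "\<Omega> = {P. \<exists>p1 p2 p3. triangular P p1 p2 p3}"

lemma ex1_triangular:
  assumes "p1 \<le> p2" "p2 \<le> p3" shows "\<exists>!P. triangular P p1 p2 p3"
proof -
  have "\<exists>!P. \<forall>r\<in>{0..1}. rcut P r = {p1 + r * (p2 - p1)..p3 - r * (p3 - p2)}"
    by (rule ex1_fuzzy_of_ends)
      (use assms in \<open>auto intro!: tendsto_intros mult_right_mono
        tendsto_eq_rhs[OF tendsto_add[OF tendsto_const tendsto_mult_right[OF tendsto_ident_at]]]
        tendsto_eq_rhs[OF tendsto_diff[OF tendsto_const tendsto_mult_right[OF tendsto_ident_at]]]\<close>)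
  then show ?thesis using assms by (simp add: triangular_def)
qed

text \<open>The components of a triangular fuzzy number can be read off its cuts at levels 0 and 1.\<close>

definition comp1 :: "fuzzy \<Rightarrow> real" where "comp1 P = lower P 0"
definition comp2 :: "fuzzy \<Rightarrow> real" where "comp2 P = lower P 1"
definition comp3 :: "fuzzy \<Rightarrow> real" where "comp3 P = upper P 0"

lemma triangular_comps:
  assumes "triangular P p1 p2 p3" shows "comp1 P = p1" "comp2 P = p2" "comp3 P = p3"
  using assms ends_of_cut[of P 0 p1 p3] ends_of_cut[of P 1 p2 p2]
  by (auto simp: triangular_def comp1_def comp2_def comp3_def)


section \<open>Generalized Hukuhara difference and derivatives\<close>

definition is_gH_diff :: "fuzzy \<Rightarrow> fuzzy \<Rightarrow> fuzzy \<Rightarrow> bool" where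
  "is_gH_diff P Q R \<longleftrightarrow> P = Q + R \<or> Q = P + (-1) *\<^sub>R R"

definition gH_diff :: "fuzzy \<Rightarrow> fuzzy \<Rightarrow> fuzzy" (infixl \<open>\<ominus>\<^sub>g\<^sub>H\<close> 65) where
  "P \<ominus>\<^sub>g\<^sub>H Q = (THE R. is_gH_diff P Q R)"

lemma is_gH_diff_unique:
  assumes "is_gH_diff P Q R" "is_gH_diff P Q S" shows "R = S"
proof -
  have "lower R r = lower S r \<and> upper R r = upper S r" if r: "r \<in> {0..1}" for r
  proof -
    have ends: "(lower P r = lower Q r + lower T r \<and> upper P r = upper Q r + upper T r) \<or>
        (lower Q r = lower P r - upper T r \<and> upper Q r = upper P r - lower T r)"
      if "is_gH_diff P Q T" for T
      using that ends_plus[OF r] ends_scaleR[OF r, of "-1" T] unfolding is_gH_diff_def by auto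
    show ?thesis
      using ends[OF assms(1)] ends[OF assms(2)] cut_eq(2)[OF r, of R] cut_eq(2)[OF r, of S]
      by linarith
  qed
  then show ?thesis by (intro ends_inject) auto
qed

lemma gH_diff_eq: "is_gH_diff P Q R \<Longrightarrow> P \<ominus>\<^sub>g\<^sub>H Q = R"
  unfolding gH_diff_def using is_gH_diff_unique by blast

text \<open>
  Fuzzy functions on \<open>[0, \<infinity>)\<close> are total functions on the reals that are only
  used at points \<open>t > 0\<close>, so the limits below depend only on their values near \<open>t\<close>.
  As \<open>\<ominus>\<^sub>g\<^sub>H\<close> is a definite description, these limits are
  meaningful only if the differences exist near \<open>t\<close>.  The ordering of the components in the
  limit, needed for the triple to be a triangular fuzzy number, is part of \<open>triangular\<close>.
\<close>

definition has_gH_derivative :: "(real \<Rightarrow> fuzzy) \<Rightarrow> fuzzy \<Rightarrow> real \<Rightarrow> bool" where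
  "has_gH_derivative w L t \<longleftrightarrow>
     ((\<lambda>h. (1 / h) *\<^sub>R (w (t + h) \<ominus>\<^sub>g\<^sub>H w t)) \<longlongrightarrow> L) (at 0)"

definition gH_differentiable_i :: "(real \<Rightarrow> fuzzy) \<Rightarrow> real \<Rightarrow> bool" where
  "gH_differentiable_i w t \<longleftrightarrow> (\<exists>L d1 d2 d3. has_gH_derivative w L t \<and>
     ((\<lambda>s. comp1 (w s)) has_real_derivative d1) (at t) \<and>
     ((\<lambda>s. comp2 (w s)) has_real_derivative d2) (at t) \<and>
     ((\<lambda>s. comp3 (w s)) has_real_derivative d3) (at t) \<and>
     triangular L d1 d2 d3)"

definition gH_differentiable_ii :: "(real \<Rightarrow> fuzzy) \<Rightarrow> real \<Rightarrow> bool" where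
  "gH_differentiable_ii w t \<longleftrightarrow> (\<exists>L d1 d2 d3. has_gH_derivative w L t \<and>
     ((\<lambda>s. comp1 (w s)) has_real_derivative d1) (at t) \<and>
     ((\<lambda>s. comp2 (w s)) has_real_derivative d2) (at t) \<and>
     ((\<lambda>s. comp3 (w s)) has_real_derivative d3) (at t) \<and>
     triangular L d3 d2 d1)"

text \<open>The conformable derivative of order \<open>\<alpha>\<close>, for real and for fuzzy functions.\<close>

definition has_conf_derivative :: "real \<Rightarrow> (real \<Rightarrow> real) \<Rightarrow> real \<Rightarrow> real \<Rightarrow> bool" where
  "has_conf_derivative \<alpha> f d t \<longleftrightarrow>
     ((\<lambda>\<epsilon>. (f (t + \<epsilon> * t powr (1 - \<alpha>)) - f t) / \<epsilon>) \<longlongrightarrow> d) (at 0)"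

definition has_conf_gH_derivative :: "real \<Rightarrow> (real \<Rightarrow> fuzzy) \<Rightarrow> fuzzy \<Rightarrow> real \<Rightarrow> bool" where
  "has_conf_gH_derivative \<alpha> w L t \<longleftrightarrow>
     ((\<lambda>\<epsilon>. (1 / \<epsilon>) *\<^sub>R (w (t + \<epsilon> * t powr (1 - \<alpha>)) \<ominus>\<^sub>g\<^sub>H w t)) \<longlongrightarrow> L) (at 0)"

definition conf_gH_differentiable_i :: "real \<Rightarrow> (real \<Rightarrow> fuzzy) \<Rightarrow> real \<Rightarrow> bool" where
  "conf_gH_differentiable_i \<alpha> w t \<longleftrightarrow> (\<exists>L d1 d2 d3. has_conf_gH_derivative \<alpha> w L t \<and>
     has_conf_derivative \<alpha> (\<lambda>s. comp1 (w s)) d1 t \<and>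
     has_conf_derivative \<alpha> (\<lambda>s. comp2 (w s)) d2 t \<and>
     has_conf_derivative \<alpha> (\<lambda>s. comp3 (w s)) d3 t \<and>
     triangular L d1 d2 d3)"

definition conf_gH_differentiable_ii :: "real \<Rightarrow> (real \<Rightarrow> fuzzy) \<Rightarrow> real \<Rightarrow> bool" where
  "conf_gH_differentiable_ii \<alpha> w t \<longleftrightarrow> (\<exists>L d1 d2 d3. has_conf_gH_derivative \<alpha> w L t \<and>
     has_conf_derivative \<alpha> (\<lambda>s. comp1 (w s)) d1 t \<and>
     has_conf_derivative \<alpha> (\<lambda>s. comp2 (w s)) d2 t \<and>
     has_conf_derivative \<alpha> (\<lambda>s. comp3 (w s)) d3 t \<and>
     triangular L d3 d2 d1)"

end

theory Submission
  imports Defs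
begin

text \<open>
  The conformable derivative at a fixed point \<open>t > 0\<close> is the ordinary derivative up to a positive
  factor.  Put \<open>c = t powr (1 - \<alpha>)\<close>.  The increment \<open>h = \<epsilon> * c\<close> runs through a punctured
  neighbourhood of \<open>0\<close> exactly when \<open>\<epsilon>\<close> does, and dividing by \<open>\<epsilon>\<close> instead of \<open>h\<close> multiplies
  the difference quotient by \<open>c\<close>.  This applies to the three real components
  (\<open>has_conf_derivative_iff\<close>) and, because scaling by a fixed real is continuous in the Hausdorff
  metric and invertible, to the fuzzy quotient as well (\<open>has_conf_gH_derivative_iff\<close>): the limit
  \<open>L\<close> and the component derivatives are all multiplied by the same \<open>c\<close>.

  A positive factor preserves the order of the three components, so it maps triangular numbers to
  triangular numbers with scaled components (\<open>triangular_scaleR_iff\<close>).  Hence it does not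
  interchange the two types of differentiability, and both equivalences follow from the bijective
  rescaling of the witnesses \<open>(L, d1, d2, d3)\<close>.
\<close>

lemma scaleR_scaleR_fuzzy: "a *\<^sub>R (b *\<^sub>R P) = (a * b) *\<^sub>R (P :: fuzzy)"
  by (rule cut_inject) (simp add: cut_scaleR image_image mult.assoc)

lemma scaleR_one_fuzzy: "1 *\<^sub>R P = (P :: fuzzy)"
  by (rule cut_inject) (simp add: cut_scaleR)

lemma ends_dist_le_dist:
  assumes "r \<in> {0..1}" shows "ends_dist P Q r \<le> dist P Q"
proof -
  have "dist P Q = (SUP r\<in>{0..1}. ends_dist P Q r)"
    unfolding dist_fuzzy_def ends_dist_def ..
  then show ?thesis
    using bdd_above_ends_dist[of P Q] assms by (auto intro: cSUP_upper2)
qed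

lemma ends_dist_scaleR:
  assumes "r \<in> {0..1}" shows "ends_dist (c *\<^sub>R P) (c *\<^sub>R Q) r = \<bar>c\<bar> * ends_dist P Q r"
proof -
  have "\<bar>c * a - c * b\<bar> = \<bar>c\<bar> * \<bar>a - b\<bar>" for a b
    by (simp add: abs_mult right_diff_distrib[symmetric])
  then show ?thesis
    unfolding ends_dist_def by (auto simp: ends_scaleR[OF assms] max_mult_distrib_left max.commute)
qed

lemma dist_scaleR_fuzzy_le: "dist (c *\<^sub>R P) (c *\<^sub>R Q) \<le> \<bar>c\<bar> * dist P (Q :: fuzzy)"
proof -
  have "dist (c *\<^sub>R P) (c *\<^sub>R Q) = (SUP r\<in>{0..1}. ends_dist (c *\<^sub>R P) (c *\<^sub>R Q) r)"
    unfolding dist_fuzzy_def ends_dist_def ..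
  also have "\<dots> \<le> \<bar>c\<bar> * dist P Q"
    by (rule cSUP_least) (auto simp: ends_dist_scaleR intro!: mult_left_mono ends_dist_le_dist)
  finally show ?thesis .
qed

lemma tendsto_scaleR_fuzzy:
  fixes g :: "'a \<Rightarrow> fuzzy"
  assumes "(g \<longlongrightarrow> L) F" shows "((\<lambda>x. c *\<^sub>R g x) \<longlongrightarrow> c *\<^sub>R L) F"
proof -
  have "((\<lambda>x. \<bar>c\<bar> * dist (g x) L) \<longlongrightarrow> 0) F"
    using assms by (intro tendsto_mult_right_zero) (simp add: tendsto_dist_iff[symmetric])
  then have "((\<lambda>x. dist (c *\<^sub>R g x) (c *\<^sub>R L)) \<longlongrightarrow> 0) F"
    by (rule tendsto_sandwich[rotated 2, OF tendsto_const]) (simp_all add: dist_scaleR_fuzzy_le)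
  then show ?thesis by (simp add: tendsto_dist_iff[symmetric])
qed

text \<open>For \<open>c \<noteq> 0\<close>, multiplication by \<open>1 / c\<close> undoes the scaling and is itself continuous.\<close>

lemma tendsto_scaleR_fuzzy_iff:
  fixes g :: "'a \<Rightarrow> fuzzy"
  assumes "c \<noteq> 0" shows "((\<lambda>x. c *\<^sub>R g x) \<longlongrightarrow> c *\<^sub>R L) F \<longleftrightarrow> (g \<longlongrightarrow> L) F"
  using tendsto_scaleR_fuzzy[of "\<lambda>x. c *\<^sub>R g x" "c *\<^sub>R L" F "1 / c"]
    tendsto_scaleR_fuzzy[of g L F c] assms
  by (auto simp: scaleR_scaleR_fuzzy scaleR_one_fuzzy)

lemma tendsto_at_0_rescale_iff:
  fixes g :: "real \<Rightarrow> 'a :: topological_space"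
  assumes "c \<noteq> 0" shows "((\<lambda>\<epsilon>. g (\<epsilon> * c)) \<longlongrightarrow> L) (at 0) \<longleftrightarrow> (g \<longlongrightarrow> L) (at 0)"
proof -
  have scale: "filterlim (\<lambda>x. x * d) (at 0) (at 0)" if "d \<noteq> 0" for d :: real
    using that by (auto simp: filterlim_at eventually_at_filter intro!: tendsto_eq_intros)
  show ?thesis
    using filterlim_compose[OF _ scale[of c], of g "nhds L"]
      filterlim_compose[OF _ scale[of "1 / c"], of "\<lambda>\<epsilon>. g (\<epsilon> * c)" "nhds L"] assms
    by auto
qed

text \<open>Multiplication by \<open>c > 0\<close> preserves the order of the components; \<open>1 / c\<close> gives the converse.\<close>

lemma triangular_scaleR_iff:
  assumes c: "c > 0"
  shows "triangular (c *\<^sub>R P) (c * p1) (c * p2) (c * p3) \<longleftrightarrow> triangular P p1 p2 p3"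
proof -
  have scale: "triangular (d *\<^sub>R Q) (d * q1) (d * q2) (d * q3)"
    if "triangular Q q1 q2 q3" "d > 0" for d Q q1 q2 q3
    using that unfolding triangular_def
    by (simp add: cut_scaleR image_mult_atLeastAtMost) (simp add: algebra_simps)
  show ?thesis
    using scale[of P p1 p2 p3 c] scale[of "c *\<^sub>R P" "c * p1" "c * p2" "c * p3" "1 / c"] c
    by (auto simp: scaleR_scaleR_fuzzy scaleR_one_fuzzy)
qed

lemma has_conf_derivative_iff:
  assumes "t > 0"
  shows "has_conf_derivative \<alpha> f (t powr (1 - \<alpha>) * d) t \<longleftrightarrow> (f has_real_derivative d) (at t)"
proof -
  define c where "c = t powr (1 - \<alpha>)"
  define q where "q h = (f (t + h) - f t) / h" for h
  have c: "c \<noteq> 0" using assms by (simp add: c_def)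
  have "(f (t + \<epsilon> * c) - f t) / \<epsilon> = c * q (\<epsilon> * c)" for \<epsilon>
    using c by (simp add: q_def)
  then have "has_conf_derivative \<alpha> f (c * d) t \<longleftrightarrow> ((\<lambda>\<epsilon>. c * q (\<epsilon> * c)) \<longlongrightarrow> c * d) (at 0)"
    by (simp add: has_conf_derivative_def c_def)
  also have "\<dots> \<longleftrightarrow> (q \<longlongrightarrow> d) (at 0)"
    using c by (simp add: tendsto_at_0_rescale_iff)
  also have "\<dots> \<longleftrightarrow> (f has_real_derivative d) (at t)"
    by (simp add: DERIV_def q_def[abs_def])
  finally show ?thesis by (simp add: c_def)
qed

lemma has_conf_gH_derivative_iff:
  assumes "t > 0"
  shows "has_conf_gH_derivative \<alpha> w (t powr (1 - \<alpha>) *\<^sub>R L) t \<longleftrightarrow> has_gH_derivative w L t"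
proof -
  define c where "c = t powr (1 - \<alpha>)"
  define q where "q h = (1 / h) *\<^sub>R (w (t + h) \<ominus>\<^sub>g\<^sub>H w t)" for h
  have c: "c \<noteq> 0" using assms by (simp add: c_def)
  have "(1 / \<epsilon>) *\<^sub>R (w (t + \<epsilon> * c) \<ominus>\<^sub>g\<^sub>H w t) = c *\<^sub>R q (\<epsilon> * c)" for \<epsilon>
    using c by (simp add: q_def scaleR_scaleR_fuzzy)
  then have "has_conf_gH_derivative \<alpha> w (c *\<^sub>R L) t \<longleftrightarrow>
      ((\<lambda>\<epsilon>. c *\<^sub>R q (\<epsilon> * c)) \<longlongrightarrow> c *\<^sub>R L) (at 0)"
    by (simp add: has_conf_gH_derivative_def c_def)
  also have "\<dots> \<longleftrightarrow> (q \<longlongrightarrow> L) (at 0)"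
    using c by (simp add: tendsto_scaleR_fuzzy_iff tendsto_at_0_rescale_iff)
  also have "\<dots> \<longleftrightarrow> has_gH_derivative w L t"
    by (simp add: has_gH_derivative_def q_def[abs_def])
  finally show ?thesis by (simp add: c_def)
qed

text \<open>
  Every fuzzy number and every real is a multiple by \<open>c\<close>, so the witnesses of a conformable
  derivative may be written as \<open>c\<close> times the witnesses of an ordinary one.
\<close>

lemma ex_scaleR_witnesses_iff:
  fixes c :: real
  assumes "c \<noteq> 0"
  shows "(\<exists>(L :: fuzzy) d1 d2 d3. P L d1 d2 d3) \<longleftrightarrow>
    (\<exists>L d1 d2 d3. P (c *\<^sub>R L) (c * d1) (c * d2) (c * d3))"
proof
  assume "\<exists>L d1 d2 d3. P L d1 d2 d3"
  then obtain L d1 d2 d3 where "P L d1 d2 d3" by blast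
  then have "P (c *\<^sub>R ((1 / c) *\<^sub>R L)) (c * (d1 / c)) (c * (d2 / c)) (c * (d3 / c))"
    using assms by (simp add: scaleR_scaleR_fuzzy scaleR_one_fuzzy)
  then show "\<exists>L d1 d2 d3. P (c *\<^sub>R L) (c * d1) (c * d2) (c * d3)" by blast
qed blast

theorem theorem3p3:
  fixes w :: "real \<Rightarrow> fuzzy" and \<alpha> \<tau>\<^sub>0 :: real
  assumes "0 < \<alpha>" "\<alpha> < 1" and "0 < \<tau>\<^sub>0"
    and "\<forall>t\<ge>0. w t \<in> \<Omega>"
    and "\<forall>\<^sub>F s in at \<tau>\<^sub>0. \<exists>R\<in>\<Omega>. is_gH_diff (w s) (w \<tau>\<^sub>0) R"
  shows "(gH_differentiable_i w \<tau>\<^sub>0 \<longleftrightarrow> conf_gH_differentiable_i \<alpha> w \<tau>\<^sub>0) \<and>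
    (gH_differentiable_ii w \<tau>\<^sub>0 \<longleftrightarrow> conf_gH_differentiable_ii \<alpha> w \<tau>\<^sub>0)"
proof -
  have c: "\<tau>\<^sub>0 powr (1 - \<alpha>) > 0" using \<open>0 < \<tau>\<^sub>0\<close> by simp
  note rescale = ex_scaleR_witnesses_iff[OF less_imp_neq[OF c, symmetric]]
  note rules = has_conf_gH_derivative_iff[OF \<open>0 < \<tau>\<^sub>0\<close>] has_conf_derivative_iff[OF \<open>0 < \<tau>\<^sub>0\<close>]
    triangular_scaleR_iff[OF c]
  have "conf_gH_differentiable_i \<alpha> w \<tau>\<^sub>0 \<longleftrightarrow> gH_differentiable_i w \<tau>\<^sub>0"
    unfolding conf_gH_differentiable_i_def gH_differentiable_i_def by (subst rescale) (simp only: rules)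
  moreover have "conf_gH_differentiable_ii \<alpha> w \<tau>\<^sub>0 \<longleftrightarrow> gH_differentiable_ii w \<tau>\<^sub>0"
    unfolding conf_gH_differentiable_ii_def gH_differentiable_ii_def by (subst rescale) (simp only: rules)
  ultimately show ?thesis by blast
qed

end
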